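(* Consider a single DRCCP ($I=1$) under the type $\infty$-Wasserstein ambiguity set with affine mappings $a_1(x)=x$, $b_1(x)=b_1\ge0$ (a constant), where the norm $\|\cdot\|$ is the generalized Mahalanobis norm associated with the matrix $\Sigma=\mu\mu^\top$ and $\mu^\top x\ge0$ for every $x\in\mathcal X$. Suppose the reference distribution is discrete with $\mathbb{P}_\zeta\{\tilde\zeta=\zeta_i\mu\}=p_i\ge0$ for all $i\in[N]$, where $\sum_{i\in[N]}p_i=1$ and $0\le\zeta_1<\zeta_2<\cdots<\zeta_N$ are scalars. Then ALSO-X# is exact, i.e., $v^{A\#}=v^*$.
   Context: $\mathcal X\subseteq\mathbb{R}^n$, $c,\mu\in\mathbb{R}^n$, $\varepsilon\in(0,1)$, $\theta\ge0$, $[N]=\{1,\dots,N\}$, $(y)_+=\max\{y,0\}$. The generalized Mahalanobis norm is $\|y\|=\sqrt{y^\top\Sigma^\dagger y}$ ($\Sigma^\dagger$ the pseudo-inverse), whose dual norm is taken to be $\|x\|_*=\sqrt{x^\top\Sigma x}=|\mu^\top x|$. DRCCP: $v^*=\min\{c^\top x:x\in\mathcal X,\ \mathbb{P}_\zeta\{\theta\|x\|_*+x^\top\tilde\zeta\le b_1\}\ge1-\varepsilon\}$. ALSO-X#: $v^{A\#}$ is the minimum (infimum) of all $t$ for which there is $(x^*,\beta^* )\in\arg\min\{\varepsilon\beta+\mathbb{E}_{\mathbb{P}_\zeta}[(\theta\|x\|_*+x^\top\tilde\zeta-b_1-\beta)_+]:x\in\mathcal X,\ c^\top x\le t,\ \beta\le0\}$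 with $\mathbb{P}_\zeta\{\theta\|x^*\|_*+(x^* )^\top\tilde\zeta\le b_1\}\ge1-\varepsilon$. Conventions: an infimum over the empty set is $+\infty$; the minimization problems are understood to attain their minima whenever feasible. *)

theory Defs
  imports "HOL-Probability.Probability"
begin

(* Dual of the generalized Mahalanobis norm y |-> sqrt (y^T S^+ y), with S^+ the pseudo-inverse
   of S. For singular S this is the convention sqrt (x^T S x), i.e. the dual taken on the range
   of S only; the pseudo-inverse itself does not enter. *)
definition mahalanobis_dual_norm :: "real^'n^'n \<Rightarrow> real^'n \<Rightarrow> real" where
  "mahalanobis_dual_norm S x = sqrt (x \<bullet> (S *v x))"

lemma mahalanobis_dual_norm_rank_one:
  "mahalanobis_dual_norm (\<chi> i j. \<mu> $ i * \<mu> $ j) x = \<bar>\<mu> \<bullet> x\<bar>"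
proof -
  have "((\<chi> i j. \<mu> $ i * \<mu> $ j) *v x) $ i = (\<mu> \<bullet> x) * \<mu> $ i" for i
  proof -
    have "((\<chi> i j. \<mu> $ i * \<mu> $ j) *v x) $ i = (\<Sum>j\<in>UNIV. \<mu> $ i * \<mu> $ j * x $ j)"
      by (simp add: matrix_vector_mult_def)
    also have "\<dots> = (\<Sum>j\<in>UNIV. \<mu> $ j * x $ j) * \<mu> $ i"
      unfolding sum_distrib_right by (rule sum.cong) simp_all
    finally show ?thesis by (simp add: inner_vec_def)
  qed
  then have "(\<chi> i j. \<mu> $ i * \<mu> $ j) *v x = (\<mu> \<bullet> x) *\<^sub>R \<mu>"
    by (simp add: vec_eq_iff)
  then show ?thesis
    by (simp add: mahalanobis_dual_norm_def inner_commute)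
qed

(* P is the sum over i in {1..N} of p i times the point mass at z i. Points z i that coincide
   have their weights added, so that z need not be injective. *)
definition discrete_law :: "'a pmf \<Rightarrow> nat \<Rightarrow> (nat \<Rightarrow> real) \<Rightarrow> (nat \<Rightarrow> 'a) \<Rightarrow> bool" where
  "discrete_law P N p z \<longleftrightarrow> (\<forall>v. measure_pmf.prob P {v} = (\<Sum>i | i \<in> {1..N} \<and> z i = v. p i))"

lemma discrete_law_iff_inj:
  assumes inj: "inj_on z {1..N}" and sum: "(\<Sum>i=1..N. p i) = 1"
  shows "discrete_law P N p z \<longleftrightarrow> (\<forall>i\<in>{1..N}. measure_pmf.prob P {z i} = p i)"
proof -
  have eq: "(\<Sum>j | j \<in> {1..N} \<and> z j = z i. p j) = p i" if "i \<in> {1..N}" for i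
  proof -
    have "{j. j \<in> {1..N} \<and> z j = z i} = {i}"
      using inj that unfolding inj_on_def by blast
    then show ?thesis by (simp only: sum.insert finite.emptyI) simp
  qed
  show ?thesis
  proof (intro iffI ballI)
    fix i assume "discrete_law P N p z" and i: "i \<in> {1..N}"
    then have "measure_pmf.prob P {z i} = (\<Sum>j | j \<in> {1..N} \<and> z j = z i. p j)"
      unfolding discrete_law_def by blast
    then show "measure_pmf.prob P {z i} = p i"
      unfolding eq[OF i] .
  next
    assume pt: "\<forall>i\<in>{1..N}. measure_pmf.prob P {z i} = p i"
    have "measure_pmf.prob P (z ` {1..N}) = (\<Sum>v\<in>z ` {1..N}. pmf P v)"
      by (rule measure_measure_pmf_finite) simp
    also have "\<dots> = (\<Sum>i=1..N. pmf P (z i))"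
      by (simp only: sum.reindex[OF inj] o_def)
    also have "\<dots> = (\<Sum>i=1..N. p i)"
      using pt by (intro sum.cong) (simp_all only: measure_pmf_single)
    finally have "measure_pmf.prob P (z ` {1..N}) = 1"
      by (simp only: sum)
    then have "AE v in measure_pmf P. v \<in> z ` {1..N}"
      by (subst (asm) measure_pmf.prob_eq_1) simp_all
    then have supp: "set_pmf P \<subseteq> z ` {1..N}"
      unfolding AE_measure_pmf_iff by blast
    have "measure_pmf.prob P {v} = (\<Sum>i | i \<in> {1..N} \<and> z i = v. p i)" for v
    proof (cases "v \<in> z ` {1..N}")
      case True
      then obtain i where i: "i \<in> {1..N}" and v: "v = z i" by blast
      show ?thesis unfolding v eq[OF i] using pt i by blast
    next
      case False
      then have e: "{i. i \<in> {1..N} \<and> z i = v} = {}" by blast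
      have "v \<notin> set_pmf P" using False supp by blast
      then have "pmf P v = 0" by (simp only: set_pmf_iff not_not)
      then show ?thesis unfolding e measure_pmf_single by simp
    qed
    then show "discrete_law P N p z"
      unfolding discrete_law_def by blast
  qed
qed

definition chance_constraint ::
  "(real^'n) pmf \<Rightarrow> real \<Rightarrow> real \<Rightarrow> (real^'n \<Rightarrow> real) \<Rightarrow> real \<Rightarrow> real^'n \<Rightarrow> bool" where
  "chance_constraint P \<epsilon> \<theta> dn b x \<longleftrightarrow>
     measure_pmf.prob P {z. \<theta> * dn x + x \<bullet> z \<le> b} \<ge> 1 - \<epsilon>"

definition drccp_feasible ::
  "(real^'n) set \<Rightarrow> (real^'n) pmf \<Rightarrow> real \<Rightarrow> real \<Rightarrow> (real^'n \<Rightarrow> real) \<Rightarrow> real \<Rightarrow> real^'n \<Rightarrow> bool" where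
  "drccp_feasible X P \<epsilon> \<theta> dn b x \<longleftrightarrow> x \<in> X \<and> chance_constraint P \<epsilon> \<theta> dn b x"

definition drccp_value ::
  "(real^'n) set \<Rightarrow> real^'n \<Rightarrow> (real^'n) pmf \<Rightarrow> real \<Rightarrow> real \<Rightarrow> (real^'n \<Rightarrow> real) \<Rightarrow> real \<Rightarrow> ereal" where
  "drccp_value X c P \<epsilon> \<theta> dn b = (INF x\<in>{x. drccp_feasible X P \<epsilon> \<theta> dn b x}. ereal (c \<bullet> x))"

definition alsox_sharp_objective ::
  "(real^'n) pmf \<Rightarrow> real \<Rightarrow> real \<Rightarrow> (real^'n \<Rightarrow> real) \<Rightarrow> real \<Rightarrow> (real^'n) \<times> real \<Rightarrow> real" where
  "alsox_sharp_objective P \<epsilon> \<theta> dn b = (\<lambda>(x, \<beta>).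
     \<epsilon> * \<beta> + measure_pmf.expectation P (\<lambda>z. max (\<theta> * dn x + x \<bullet> z - b - \<beta>) 0))"

definition alsox_sharp_feasible ::
  "(real^'n) set \<Rightarrow> real^'n \<Rightarrow> real \<Rightarrow> (real^'n) \<times> real \<Rightarrow> bool" where
  "alsox_sharp_feasible X c t = (\<lambda>(x, \<beta>). x \<in> X \<and> c \<bullet> x \<le> t \<and> \<beta> \<le> 0)"

definition alsox_sharp_value ::
  "(real^'n) set \<Rightarrow> real^'n \<Rightarrow> (real^'n) pmf \<Rightarrow> real \<Rightarrow> real \<Rightarrow> (real^'n \<Rightarrow> real) \<Rightarrow> real \<Rightarrow> ereal" where
  "alsox_sharp_value X c P \<epsilon> \<theta> dn b =
     (INF t\<in>{t. \<exists>x \<beta>. is_arg_min (alsox_sharp_objective P \<epsilon> \<theta> dn b) (alsox_sharp_feasible X c t) (x, \<beta>)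
                      \<and> chance_constraint P \<epsilon> \<theta> dn b x}. ereal t)"

end

theory Submission
  imports Defs
begin

text \<open>
  Because \<open>\<Sigma>\<close> has rank one and \<open>\<mu> \<bullet> x \<ge> 0\<close>, the dual norm of a decision \<open>x\<close> is
  \<open>m = \<mu> \<bullet> x\<close>, and at a scenario \<open>\<zeta>\<^sub>i *\<^sub>R \<mu>\<close> the left-hand side of the chance constraint is
  \<open>m * (\<theta> + \<zeta>\<^sub>i)\<close>.  So \<open>x\<close> enters the constraint and the inner objective only
  through the scalar \<open>m \<ge> 0\<close>, which multiplies one nonnegative random variable \<open>w = \<theta> + \<zeta>\<close>.

  This makes the inner problem of ALSO-X# prefer feasible decisions strictly.  Suppose that
  \<open>m'\<close> satisfies the chance constraint and \<open>m\<close> violates it.  The event \<open>m * w > b\<close> has probability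
  greater than \<open>\<epsilon>\<close>; let \<open>q\<close> be the least value of \<open>w\<close> in it.  By its probability this event
  meets \<open>m' * w \<le> b\<close>, which has probability at least \<open>1 - \<epsilon>\<close>.  Hence \<open>m' * q \<le> b < m * q\<close>, so
  \<open>m' * q - b \<le> 0\<close> is an admissible \<open>\<beta>\<close> for \<open>m'\<close>.  Its objective value is
  \<open>\<epsilon> * (m' * q - b) + m' * E (w - q)\<^sub>+\<close>, whereas bounding the expectation on \<open>w \<ge> q\<close> shows that
  for \<open>m\<close> every \<open>\<beta> \<le> 0\<close> gives more than \<open>\<epsilon> * (m * q - b) + m * E (w - q)\<^sub>+\<close>.  The
  latter is at least the former, since \<open>m' < m\<close> and \<open>q \<ge> 0\<close> (lemma \<open>scaled_feasible_beats_infeasible\<close>).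

  Hence, if \<open>x'\<close> is feasible for the DRCCP, every minimizer of the inner problem at the level
  \<open>t = c \<bullet> x'\<close> satisfies the chance constraint, so that \<open>t\<close> is an ALSO-X# level.  Conversely, each
  ALSO-X# level \<open>t\<close> comes with a point feasible for the DRCCP and of cost at most \<open>t\<close>.
\<close>

lemma set_pmf_discrete_law:
  assumes "discrete_law P N p z"
  shows "set_pmf P \<subseteq> z ` {1..N}" and "finite (set_pmf P)"
proof -
  show sub: "set_pmf P \<subseteq> z ` {1..N}"
  proof
    fix v assume "v \<in> set_pmf P"
    then have "(\<Sum>i | i \<in> {1..N} \<and> z i = v. p i) \<noteq> 0"
      using assms by (simp add: discrete_law_def measure_pmf_single set_pmf_iff)
    then have "{i. i \<in> {1..N} \<and> z i = v} \<noteq> {}"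
      by (metis sum.empty)
    then show "v \<in> z ` {1..N}" by blast
  qed
  show "finite (set_pmf P)"
    using finite_subset[OF sub] by simp
qed

text \<open>
  The strictness comes from \<open>P (m * w > b) > \<epsilon>\<close>: the slope of the objective in \<open>\<beta>\<close> is below zero
  for all \<open>\<beta> < m * q - b\<close>, and \<open>\<beta> \<le> 0\<close> keeps \<open>\<beta>\<close> below \<open>m * q - b > 0\<close>.
\<close>

lemma scaled_feasible_beats_infeasible:
  fixes w :: "'a \<Rightarrow> real" and \<epsilon> b m m' \<beta> :: real
  assumes fin: "finite (set_pmf P)"
    and w_nonneg: "\<And>z. z \<in> set_pmf P \<Longrightarrow> w z \<ge> 0"
    and eps: "\<epsilon> \<ge> 0" and m': "m' \<ge> 0" and beta: "\<beta> \<le> 0"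
    and feas: "measure_pmf.prob P {z. m' * w z \<le> b} \<ge> 1 - \<epsilon>"
    and infeas: "measure_pmf.prob P {z. m * w z \<le> b} < 1 - \<epsilon>"
  shows "\<exists>\<beta>'\<le>0. \<epsilon> * \<beta>' + measure_pmf.expectation P (\<lambda>z. max (m' * w z - b - \<beta>') 0)
                < \<epsilon> * \<beta> + measure_pmf.expectation P (\<lambda>z. max (m * w z - b - \<beta>) 0)"
proof -
  have integrable: "integrable (measure_pmf P) f" for f :: "'a \<Rightarrow> real"
    by (rule integrable_measure_pmf_finite[OF fin])
  define T where "T = {z \<in> set_pmf P. b < m * w z}"
  have "\<exists>z\<in>T. m' * w z \<le> b"
  proof (rule ccontr)
    assume "\<not> (\<exists>z\<in>T. m' * w z \<le> b)"
    have "m * w z \<le> b" if "z \<in> set_pmf P" "m' * w z \<le> b" for z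
      using that \<open>\<not> (\<exists>z\<in>T. m' * w z \<le> b)\<close> unfolding T_def by (blast intro: leI)
    then have "measure_pmf.prob P {z. m' * w z \<le> b} \<le> measure_pmf.prob P {z. m * w z \<le> b}"
      by (intro measure_pmf.finite_measure_mono_AE) (auto simp: AE_measure_pmf_iff)
    then show False using feas infeas by linarith
  qed
  then obtain z0 where z0: "z0 \<in> T" "m' * w z0 \<le> b" by blast
  have "finite T" using fin by (simp add: T_def)
  define q where "q = Min (w ` T)"
  have q_in: "q \<in> w ` T"
    unfolding q_def using \<open>finite T\<close> z0 by (intro Min_in) auto
  have q_le: "q \<le> w z" if "z \<in> T" for z
    unfolding q_def using \<open>finite T\<close> that by (intro Min_le) auto
  have q_nonneg: "q \<ge> 0" and mq: "b < m * q"
    using q_in w_nonneg by (auto simp: T_def)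
  have m'q: "m' * q \<le> b"
    using mult_left_mono[OF q_le[OF z0(1)] m'] z0(2) by linarith
  have m'_less: "m' < m"
    using mult_right_mono[OF _ q_nonneg, of m m'] mq m'q by linarith
  have tail: "\<epsilon> < measure_pmf.prob P {z. q \<le> w z}"
  proof -
    have "1 - measure_pmf.prob P {z. m * w z \<le> b} = measure_pmf.prob P {z. b < m * w z}"
      by (subst measure_pmf.prob_compl[symmetric]) (auto intro!: arg_cong[where f = "measure P"])
    also have "\<dots> \<le> measure_pmf.prob P {z. q \<le> w z}"
      using q_le by (intro measure_pmf.finite_measure_mono_AE) (auto simp: AE_measure_pmf_iff T_def)
    finally show ?thesis using infeas by linarith
  qed
  define e where "e = measure_pmf.expectation P (\<lambda>z. max (w z - q) 0)"
  have e_nonneg: "e \<ge> 0" unfolding e_def by (rule Bochner_Integration.integral_nonneg) simp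
  define d where "d = m * q - b - \<beta>"
  have d_pos: "d > 0" using mq beta by (simp add: d_def)
  have pos_part: "max (m' * w z - b - (m' * q - b)) 0 = m' * max (w z - q) 0" for z
    using m' by (simp add: max_mult_distrib_left algebra_simps)
  have "\<epsilon> * (m' * q - b) + measure_pmf.expectation P (\<lambda>z. max (m' * w z - b - (m' * q - b)) 0)
        = \<epsilon> * (m' * q - b) + m' * e"
    unfolding pos_part e_def by simp
  also have "\<dots> \<le> \<epsilon> * (m * q - b) + m * e"
    using m'_less m'q mq eps e_nonneg by (intro add_mono mult_left_mono mult_right_mono) auto
  also have "\<dots> = \<epsilon> * \<beta> + (m * e + d * \<epsilon>)"
    by (simp add: d_def algebra_simps)
  also have "\<dots> < \<epsilon> * \<beta> + (m * e + d * measure_pmf.prob P {z. q \<le> w z})"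
    using tail d_pos by simp
  also have "m * e + d * measure_pmf.prob P {z. q \<le> w z}
      = measure_pmf.expectation P (\<lambda>z. m * max (w z - q) 0 + d * indicator {z. q \<le> w z} z)"
    unfolding e_def by (subst Bochner_Integration.integral_add) (simp_all add: integrable)
  also have "\<dots> \<le> measure_pmf.expectation P (\<lambda>z. max (m * w z - b - \<beta>) 0)"
    by (intro Bochner_Integration.integral_mono integrable) (auto simp: indicator_def d_def algebra_simps)
  finally have "\<epsilon> * (m' * q - b)
        + measure_pmf.expectation P (\<lambda>z. max (m' * w z - b - (m' * q - b)) 0)
      < \<epsilon> * \<beta> + measure_pmf.expectation P (\<lambda>z. max (m * w z - b - \<beta>) 0)"
    by simp
  then show ?thesis using m'q by (intro exI[of _ "m' * q - b"]) simp
qed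

text \<open>
  The witness of an ALSO-X# level \<open>t\<close> is itself feasible for the DRCCP, and its cost is at most \<open>t\<close>.
\<close>

lemma drccp_value_le_alsox_sharp_value:
  "drccp_value X c P \<epsilon> \<theta> dn b \<le> alsox_sharp_value X c P \<epsilon> \<theta> dn b"
  unfolding alsox_sharp_value_def
proof (rule INF_greatest)
  fix t assume "t \<in> {t. \<exists>x \<beta>. is_arg_min (alsox_sharp_objective P \<epsilon> \<theta> dn b)
                  (alsox_sharp_feasible X c t) (x, \<beta>) \<and> chance_constraint P \<epsilon> \<theta> dn b x}"
  then obtain x where "drccp_feasible X P \<epsilon> \<theta> dn b x" and "c \<bullet> x \<le> t"
    by (auto simp: is_arg_min_def alsox_sharp_feasible_def drccp_feasible_def)
  then show "drccp_value X c P \<epsilon> \<theta> dn b \<le> ereal t"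
    unfolding drccp_value_def by (intro INF_lower2[of x]) auto
qed

theorem corollary8:
  fixes X :: "(real^'n) set" and c \<mu> :: "real^'n"
    and S :: "real^'n^'n" and dn :: "real^'n \<Rightarrow> real"
    and P :: "(real^'n) pmf" and \<epsilon> \<theta> b\<^sub>1 :: real
    and N :: nat and p \<zeta> :: "nat \<Rightarrow> real"
  assumes "0 < \<epsilon>" and "\<epsilon> < 1" and "\<theta> \<ge> 0" and "b\<^sub>1 \<ge> 0"
    and "S = (\<chi> i j. \<mu> $ i * \<mu> $ j)"
    and "dn = mahalanobis_dual_norm S"
    and "\<And>x. x \<in> X \<Longrightarrow> \<mu> \<bullet> x \<ge> 0"
    and "\<And>i. i \<in> {1..N} \<Longrightarrow> p i \<ge> 0" and "(\<Sum>i=1..N. p i) = 1"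
    and "\<And>i. i \<in> {1..N} \<Longrightarrow> \<zeta> i \<ge> 0" and "strict_mono_on {1..N} \<zeta>"
    and "discrete_law P N p (\<lambda>i. \<zeta> i *\<^sub>R \<mu>)"
    \<comment> \<open>both minimization problems attain their minima whenever they are feasible\<close>
    and "(\<exists>x. drccp_feasible X P \<epsilon> \<theta> dn b\<^sub>1 x) \<Longrightarrow>
           \<exists>x. is_arg_min (\<lambda>x. c \<bullet> x) (drccp_feasible X P \<epsilon> \<theta> dn b\<^sub>1) x"
    and "\<And>t. (\<exists>y. alsox_sharp_feasible X c t y) \<Longrightarrow>
           \<exists>y. is_arg_min (alsox_sharp_objective P \<epsilon> \<theta> dn b\<^sub>1) (alsox_sharp_feasible X c t) y"
  shows "alsox_sharp_value X c P \<epsilon> \<theta> dn b\<^sub>1 = drccp_value X c P \<epsilon> \<theta> dn b\<^sub>1"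
proof (rule antisym[OF _ drccp_value_le_alsox_sharp_value])
  have dn_eq: "dn x = \<mu> \<bullet> x" if "x \<in> X" for x
    using assms(7)[OF that] unfolding assms(5,6) mahalanobis_dual_norm_rank_one by simp
  note support = set_pmf_discrete_law[OF assms(12)]
  \<comment> \<open>The quotient recovers the scalar \<open>\<zeta>\<^sub>i\<close> from the scenario \<open>\<zeta>\<^sub>i *\<^sub>R \<mu>\<close>. If \<open>\<mu> = 0\<close>, it is \<open>0\<close>;
    that does no harm, because then \<open>w\<close> is only ever multiplied by \<open>\<mu> \<bullet> x = 0\<close>.\<close>
  define w where "w z = \<theta> + (\<mu> \<bullet> z) / (\<mu> \<bullet> \<mu>)" for z
  have w_nonneg: "w z \<ge> 0" if "z \<in> set_pmf P" for z
    using support(1) that assms(3,10) by (auto simp: w_def)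
  have lhs_eq: "\<theta> * dn x + x \<bullet> z = (\<mu> \<bullet> x) * w z" if "x \<in> X" "z \<in> set_pmf P" for x z
    using support(1) that(2)
    by (cases "\<mu> = 0") (auto simp: w_def dn_eq[OF that(1)] inner_commute algebra_simps)
  have chance_iff: "chance_constraint P \<epsilon> \<theta> dn b\<^sub>1 x \<longleftrightarrow>
      measure_pmf.prob P {z. (\<mu> \<bullet> x) * w z \<le> b\<^sub>1} \<ge> 1 - \<epsilon>" if "x \<in> X" for x
  proof -
    have "measure_pmf.prob P {z. \<theta> * dn x + x \<bullet> z \<le> b\<^sub>1}
        = measure_pmf.prob P {z. (\<mu> \<bullet> x) * w z \<le> b\<^sub>1}"
      using lhs_eq[OF that]
      by (intro measure_pmf.finite_measure_eq_AE) (auto simp: AE_measure_pmf_iff)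
    then show ?thesis by (simp add: chance_constraint_def)
  qed
  have objective_eq: "alsox_sharp_objective P \<epsilon> \<theta> dn b\<^sub>1 (x, \<beta>)
      = \<epsilon> * \<beta> + measure_pmf.expectation P (\<lambda>z. max ((\<mu> \<bullet> x) * w z - b\<^sub>1 - \<beta>) 0)"
    if "x \<in> X" for x \<beta>
    using lhs_eq[OF that] unfolding alsox_sharp_objective_def prod.case
    by (intro arg_cong2[where f = "(+)"] refl integral_cong_AE) (auto simp: AE_measure_pmf_iff)
  show "alsox_sharp_value X c P \<epsilon> \<theta> dn b\<^sub>1 \<le> drccp_value X c P \<epsilon> \<theta> dn b\<^sub>1"
    unfolding drccp_value_def
  proof (rule INF_greatest)
    fix x' assume "x' \<in> {x. drccp_feasible X P \<epsilon> \<theta> dn b\<^sub>1 x}"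
    then have x': "x' \<in> X" "chance_constraint P \<epsilon> \<theta> dn b\<^sub>1 x'"
      by (auto simp: drccp_feasible_def)
    have "alsox_sharp_feasible X c (c \<bullet> x') (x', 0)"
      using x' by (simp add: alsox_sharp_feasible_def)
    then obtain x \<beta> where arg_min: "is_arg_min (alsox_sharp_objective P \<epsilon> \<theta> dn b\<^sub>1)
        (alsox_sharp_feasible X c (c \<bullet> x')) (x, \<beta>)"
      using assms(14)[of "c \<bullet> x'"] by fast
    then have x: "x \<in> X" "\<beta> \<le> 0"
      by (auto simp: is_arg_min_def alsox_sharp_feasible_def)
    have "chance_constraint P \<epsilon> \<theta> dn b\<^sub>1 x"
    proof (rule ccontr)
      assume "\<not> chance_constraint P \<epsilon> \<theta> dn b\<^sub>1 x"
      then have "measure_pmf.prob P {z. (\<mu> \<bullet> x) * w z \<le> b\<^sub>1} < 1 - \<epsilon>"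
        using chance_iff[OF x(1)] by linarith
      with x'(2)[unfolded chance_iff[OF x'(1)]]
      obtain \<beta>' where "\<beta>' \<le> 0" and "alsox_sharp_objective P \<epsilon> \<theta> dn b\<^sub>1 (x', \<beta>')
          < alsox_sharp_objective P \<epsilon> \<theta> dn b\<^sub>1 (x, \<beta>)"
        using scaled_feasible_beats_infeasible
            [where w = w, OF support(2) w_nonneg less_imp_le[OF assms(1)] assms(7)[OF x'(1)] x(2)]
        unfolding objective_eq[OF x(1)] objective_eq[OF x'(1)] by blast
      moreover from this(1) have "alsox_sharp_feasible X c (c \<bullet> x') (x', \<beta>')"
        using x'(1) by (simp add: alsox_sharp_feasible_def)
      ultimately show False using arg_min unfolding is_arg_min_def by blast
    qed
    with arg_min show "alsox_sharp_value X c P \<epsilon> \<theta> dn b\<^sub>1 \<le> ereal (c \<bullet> x')"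
      unfolding alsox_sharp_value_def by (intro INF_lower) blast
  qed
qed

end
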